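(* For all integers $m\geq 3$ and $n\geq 2$, $$\chi_{lid}(C_m \times P_n)=\begin{cases}3 & \text{if } n \text{ is odd},\\ 3 & \text{if } m \text{ is a multiple of } 4 \text{ and } n \text{ is even},\\ 4 & \text{otherwise}.\end{cases}$$
   Context: $P_n$ denotes the path on $n$ vertices and $C_m$ the cycle on $m$ vertices. A proper $k$-coloring of a graph $G$ is a map $f:V(G)\to\{1,\dots,k\}$ with $f(u)\neq f(v)$ for every edge $uv$. For a vertex $v$, $N[v]$ denotes its closed neighborhood, and $f(S)=\{f(x):x\in S\}$. A lid-coloring of $G$ (not necessarily connected) is a proper coloring $f$ such that for every edge $uv$ with $N[u]\neq N[v]$ we have $f(N[u])\neq f(N[v])$; $\chi_{lid}(G)$ is the smallest number of colors in a lid-coloring of $G$. The tensor product $G\times H$ has vertex set $V(G)\times V(H)$, where $(u_1,v_1)$ and $(u_2,v_2)$ are adjacent iff $u_1u_2\in E(G)$ and $v_1v_2\in E(H)$. *)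

theory Defs
  imports Main
begin

record 'a ugraph =
  verts :: "'a set"
  edges :: "'a set set"

definition simple_graph :: "'a ugraph \<Rightarrow> bool" where
  "simple_graph G \<longleftrightarrow> finite (verts G) \<and> (\<forall>e\<in>edges G. e \<subseteq> verts G \<and> card e = 2)"

definition path_graph :: "nat \<Rightarrow> nat ugraph" where
  "path_graph n = \<lparr>verts = {0..<n}, edges = {{i, i + 1} | i. i + 1 < n}\<rparr>"

text \<open>Only for \<open>m \<ge> 3\<close> is this the cycle on \<open>m\<close> vertices; for smaller \<open>m\<close> it is degenerate.\<close>

definition cycle_graph :: "nat \<Rightarrow> nat ugraph" where
  "cycle_graph m = \<lparr>verts = {0..<m}, edges = {{i, (i + 1) mod m} | i. i < m}\<rparr>"

definition tensor_product :: "'a ugraph \<Rightarrow> 'b ugraph \<Rightarrow> ('a \<times> 'b) ugraph" where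
  "tensor_product G H =
     \<lparr>verts = verts G \<times> verts H,
      edges = {{(u1, v1), (u2, v2)} | u1 v1 u2 v2. {u1, u2} \<in> edges G \<and> {v1, v2} \<in> edges H}\<rparr>"

definition closed_nbhd :: "'a ugraph \<Rightarrow> 'a \<Rightarrow> 'a set" where
  "closed_nbhd G v = insert v {u \<in> verts G. {u, v} \<in> edges G}"

definition proper_coloring :: "'a ugraph \<Rightarrow> nat \<Rightarrow> ('a \<Rightarrow> nat) \<Rightarrow> bool" where
  "proper_coloring G k f \<longleftrightarrow>
     f ` verts G \<subseteq> {1..k} \<and> (\<forall>u v. {u, v} \<in> edges G \<longrightarrow> f u \<noteq> f v)"

definition lid_coloring :: "'a ugraph \<Rightarrow> nat \<Rightarrow> ('a \<Rightarrow> nat) \<Rightarrow> bool" where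
  "lid_coloring G k f \<longleftrightarrow>
     proper_coloring G k f \<and>
     (\<forall>u v. {u, v} \<in> edges G \<longrightarrow> closed_nbhd G u \<noteq> closed_nbhd G v \<longrightarrow>
        f ` closed_nbhd G u \<noteq> f ` closed_nbhd G v)"

definition lid_chromatic_number :: "'a ugraph \<Rightarrow> nat" where
  "lid_chromatic_number G = (LEAST k. \<exists>f. lid_coloring G k f)"

lemma simple_graph_path: "simple_graph (path_graph n)"
  by (auto simp: simple_graph_def path_graph_def)

lemma simple_graph_cycle:
  assumes "m \<ge> 3"
  shows "simple_graph (cycle_graph m)"
proof -
  have "i \<noteq> Suc i mod m" if "i < m" for i
    using that assms by (cases "Suc i = m") auto
  then show ?thesis
    using assms by (auto simp: simple_graph_def cycle_graph_def)
qed

lemma simple_graph_tensor: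
  assumes "simple_graph G" "simple_graph H"
  shows "simple_graph (tensor_product G H)"
proof -
  have "u1 \<noteq> u2 \<and> u1 \<in> verts G \<and> u2 \<in> verts G" if "{u1, u2} \<in> edges G" for u1 u2
    using assms(1) that by (cases "u1 = u2") (force simp: simple_graph_def)+
  moreover have "v1 \<in> verts H \<and> v2 \<in> verts H" if "{v1, v2} \<in> edges H" for v1 v2
    using assms(2) that by (force simp: simple_graph_def)
  ultimately show ?thesis
    using assms by (fastforce simp: simple_graph_def tensor_product_def)
qed

text \<open>The minimum defining the lid-chromatic number of a simple graph is attained: an injective
  coloring is a lid-coloring.\<close>

lemma ex_lid_coloring:
  assumes "simple_graph G"
  shows "\<exists>f. lid_coloring G (card (verts G)) f"
proof -
  have "finite (verts G)" using assms by (simp add: simple_graph_def)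
  then obtain f where f: "bij_betw f (verts G) {1..card (verts G)}"
    using finite_same_card_bij[of "verts G" "{1..card (verts G)}"] by auto
  have inj: "inj_on f (verts G)" and im: "f ` verts G \<subseteq> {1..card (verts G)}"
    using f by (auto simp: bij_betw_def)
  have e: "u \<noteq> v \<and> u \<in> verts G \<and> v \<in> verts G" if "{u, v} \<in> edges G" for u v
    using assms that by (cases "u = v") (force simp: simple_graph_def)+
  have nb: "closed_nbhd G u \<subseteq> verts G" if "u \<in> verts G" for u
    using that by (auto simp: closed_nbhd_def)
  have "f ` closed_nbhd G u \<noteq> f ` closed_nbhd G v"
    if uv: "{u, v} \<in> edges G" "closed_nbhd G u \<noteq> closed_nbhd G v" for u v
    using inj_on_image_eq_iff[OF inj nb[of u] nb[of v]] e[OF uv(1)] uv(2) by simp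
  moreover have "f u \<noteq> f v" if "{u, v} \<in> edges G" for u v
    using e[OF that] inj by (simp add: inj_on_eq_iff)
  ultimately have "lid_coloring G (card (verts G)) f"
    using im by (simp add: lid_coloring_def proper_coloring_def)
  then show ?thesis by auto
qed

lemma lid_chromatic_number_attained:
  assumes "simple_graph G"
  shows "\<exists>f. lid_coloring G (lid_chromatic_number G) f"
  unfolding lid_chromatic_number_def using ex_lid_coloring[OF assms] by (rule LeastI)

end

theory Submission
  imports Defs
begin

text \<open>
  The tensor product is bipartite by the parity of the path coordinate. In a lid-coloring with
  three colors, exactly one endpoint of every edge sees all three colors. If the number of layers
  is even, then along each component one of the two boundary layers sees all three colors; the
  adjacent layer sees two, which forces the boundary layer to be constant (in steps of two around
  the cycle) and the adjacent layer to alternate between the two other colors. Going around the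
  cycle once (or twice, for odd \<open>m\<close>) shows that \<open>4\<close> divides \<open>m\<close>.

  Conversely, if \<open>n\<close> is odd, color odd layers by \<open>1\<close> and even layers alternately by \<open>2\<close> and
  \<open>3\<close>. For all \<open>m\<close> and \<open>n\<close>, color odd layers by the pattern \<open>2, 2, 3, 3, \<dots>\<close> around the cycle
  and even layers by \<open>1\<close>, except by \<open>4\<close> at those cycle positions whose two cyclic neighbors carry
  the same entry of the pattern. These exceptions occur only where the pattern wraps around, and
  there are none if \<open>4\<close> divides \<open>m\<close>.
\<close>

section \<open>Edges and closed neighborhoods of the product of a cycle and a path\<close>

abbreviation cycle_times_path :: "nat \<Rightarrow> nat \<Rightarrow> (nat \<times> nat) ugraph" where
  "cycle_times_path m n \<equiv> tensor_product (cycle_graph m) (path_graph n)"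

lemma edge_cycle_graph_iff:
  "{i, i'} \<in> edges (cycle_graph m) \<longleftrightarrow>
     i < m \<and> i' < m \<and> (i' = Suc i mod m \<or> i = Suc i' mod m)"
  by (auto simp: cycle_graph_def doubleton_eq_iff)

lemma edge_path_graph_iff:
  "{j, j'} \<in> edges (path_graph n) \<longleftrightarrow> j < n \<and> j' < n \<and> (j' = Suc j \<or> j = Suc j')"
  by (auto simp: path_graph_def doubleton_eq_iff)

lemma edge_tensor_product_iff:
  "{(u, v), (u', v')} \<in> edges (tensor_product G H) \<longleftrightarrow>
     {u, u'} \<in> edges G \<and> {v, v'} \<in> edges H"
  by (auto simp: tensor_product_def doubleton_eq_iff insert_commute)

lemma edge_cycle_times_path_iff:
  "{(i, j), (i', j')} \<in> edges (cycle_times_path m n) \<longleftrightarrow>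
     i < m \<and> i' < m \<and> (i' = Suc i mod m \<or> i = Suc i' mod m) \<and>
     j < n \<and> j' < n \<and> (j' = Suc j \<or> j = Suc j')"
  by (auto simp: edge_tensor_product_iff edge_cycle_graph_iff edge_path_graph_iff)

lemma verts_cycle_times_path: "verts (cycle_times_path m n) = {0..<m} \<times> {0..<n}"
  by (simp add: tensor_product_def cycle_graph_def path_graph_def)

lemma Suc_mod_eq_iff:
  assumes "i < (m::nat)"
  shows "Suc k mod m = Suc i mod m \<longleftrightarrow> i = k mod m"
proof -
  have "k mod m < m" using assms by simp
  then show ?thesis
    using assms by (subst mod_Suc_eq[symmetric]) (auto simp: mod_Suc split: if_splits)
qed

text \<open>Writing the cycle position as \<open>Suc k mod m\<close> gives its cyclic neighbors as
  \<open>k\<close> and \<open>k + 2\<close> modulo \<open>m\<close>, with no truncated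
  subtraction.\<close>

lemma closed_nbhd_cycle_times_path:
  assumes "j < n" "0 < m"
  shows "closed_nbhd (cycle_times_path m n) (Suc k mod m, j) =
    insert (Suc k mod m, j)
      ({k mod m, (k + 2) mod m} \<times> {j'. j' < n \<and> (j' = Suc j \<or> j = Suc j')})"
proof -
  have "Suc (Suc k mod m) mod m = (k + 2) mod m" by (simp add: mod_Suc_eq)
  then show ?thesis
    using assms
    by (auto simp: closed_nbhd_def edge_cycle_times_path_iff verts_cycle_times_path
        Suc_mod_eq_iff mod_Suc_eq)
qed

lemma obtain_Suc_mod:
  assumes "i < (m::nat)"
  obtains k where "i = Suc k mod m"
proof
  \<comment> \<open>Adding \<open>m\<close> first keeps the predecessor of \<open>0\<close> from
    being truncated.\<close>
  show "i = Suc (i + m - 1) mod m" using assms by simp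
qed

lemma mod_add_2_neq:
  assumes "m \<ge> (3::nat)"
  shows "k mod m \<noteq> (k + 2) mod m"
proof
  assume "k mod m = (k + 2) mod m"
  then have "m dvd (k + 2) - k"
    by (metis mod_eq_dvd_iff_nat le_add1)
  with assms show False by (auto dest: dvd_imp_le)
qed

text \<open>\<open>u\<close> has two distinct neighbors in the layer of \<open>v\<close>, whereas
  the closed neighborhood of \<open>v\<close> meets that layer only in \<open>v\<close>. Hence the
  lid condition binds on every edge.\<close>

lemma closed_nbhd_neq:
  assumes "m \<ge> 3" "{u, v} \<in> edges (cycle_times_path m n)"
  shows "closed_nbhd (cycle_times_path m n) u \<noteq> closed_nbhd (cycle_times_path m n) v"
proof -
  obtain i j i' j' where uv: "u = (i, j)" "v = (i', j')" by (cases u, cases v)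
  have e: "i < m" "j < n" "i' < m" "j' < n" "j' = Suc j \<or> j = Suc j'"
    using assms(2) by (auto simp: uv edge_cycle_times_path_iff)
  obtain k k' where k: "i = Suc k mod m" "i' = Suc k' mod m"
    using e obtain_Suc_mod by metis
  let ?N = "closed_nbhd (cycle_times_path m n)"
  have "{(k mod m, j'), ((k + 2) mod m, j')} \<subseteq> ?N u"
    using assms e unfolding uv k by (subst closed_nbhd_cycle_times_path) auto
  moreover have "x = i'" if "(x, j') \<in> ?N v" for x
    using that assms e unfolding uv k by (subst (asm) closed_nbhd_cycle_times_path) auto
  ultimately show ?thesis using mod_add_2_neq[OF assms(1)] by blast
qed

section \<open>Criteria for lid-colorings and for the lid-chromatic number\<close>

lemma lid_coloring_mono:
  assumes "lid_coloring G k f" "k \<le> l"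
  shows "lid_coloring G l f"
  using assms by (fastforce simp: lid_coloring_def proper_coloring_def)

lemma lid_chromatic_number_eqI:
  assumes "lid_coloring G (Suc k) f" "\<And>g. \<not> lid_coloring G k g"
  shows "lid_chromatic_number G = Suc k"
  unfolding lid_chromatic_number_def
proof (rule Least_equality)
  show "\<exists>f. lid_coloring G (Suc k) f" using assms(1) by blast
  show "Suc k \<le> l" if "\<exists>f. lid_coloring G l f" for l
    using that assms(2) lid_coloring_mono not_less_eq_eq by blast
qed

text \<open>Every edge joins an even layer to an odd one, so by symmetry it suffices to check edges
  oriented from even \<open>j\<close> to odd \<open>j'\<close>.\<close>

lemma lid_coloring_cycle_times_pathI:
  assumes "f ` ({0..<m} \<times> {0..<n}) \<subseteq> {1..c}"
    and "\<And>k k' j j'. \<lbrakk>even j; j < n; odd j'; j' < n; j' = Suc j \<or> j = Suc j';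
        Suc k' mod m = k mod m \<or> Suc k' mod m = (k + 2) mod m\<rbrakk> \<Longrightarrow>
      f (Suc k mod m, j) \<noteq> f (Suc k' mod m, j') \<and>
      f ` closed_nbhd (cycle_times_path m n) (Suc k mod m, j) \<noteq>
      f ` closed_nbhd (cycle_times_path m n) (Suc k' mod m, j')"
  shows "lid_coloring (cycle_times_path m n) c f"
proof -
  let ?G = "cycle_times_path m n"
  have even_odd: "f (i, j) \<noteq> f (i', j') \<and>
      f ` closed_nbhd ?G (i, j) \<noteq> f ` closed_nbhd ?G (i', j')"
    if e: "{(i, j), (i', j')} \<in> edges ?G" and "even j" for i j i' j'
  proof -
    have e': "i < m" "j < n" "i' < m" "j' < n" "j' = Suc j \<or> j = Suc j'"
        "i' = Suc i mod m \<or> i = Suc i' mod m"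
      using e by (auto simp: edge_cycle_times_path_iff)
    then obtain k k' where k: "i = Suc k mod m" "i' = Suc k' mod m"
      using obtain_Suc_mod by metis
    have "i' = (k + 2) mod m \<or> i' = k mod m"
      using e' k Suc_mod_eq_iff[of i' m k] by (auto simp: mod_Suc_eq)
    with e' k \<open>even j\<close> show ?thesis using assms(2)[of j j' k' k] by auto
  qed
  have "f u \<noteq> f v \<and> f ` closed_nbhd ?G u \<noteq> f ` closed_nbhd ?G v"
    if e: "{u, v} \<in> edges ?G" for u v
  proof -
    obtain i j i' j' where uv: "u = (i, j)" "v = (i', j')" by (cases u, cases v)
    have "even j \<or> even j'" using e by (auto simp: uv edge_cycle_times_path_iff)
    then show ?thesis
      using even_odd[of i j i' j'] even_odd[of i' j' i j] e uv by (metis insert_commute)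
  qed
  then show ?thesis
    using assms(1) by (simp add: lid_coloring_def proper_coloring_def verts_cycle_times_path)
qed

text \<open>For odd \<open>n\<close> both boundary layers are even, so each odd layer lies between
  two even layers, one colored \<open>2\<close> and the other \<open>3\<close>. Its vertices see
  both colors, while a vertex of an even layer sees only \<open>1\<close> and its own color.\<close>

lemma lid_coloring_odd_path:
  assumes "m \<ge> 3" "odd n"
  shows "lid_coloring (cycle_times_path m n) 3
    (\<lambda>(i, j). if odd j then 1 else if 4 dvd j then 2 else 3)"
    (is "lid_coloring _ _ ?f")
proof (rule lid_coloring_cycle_times_pathI)
  fix k k' j j' :: nat
  assume j: "even j" "j < n" "odd j'" "j' < n" "j' = Suc j \<or> j = Suc j'"
  let ?N = "closed_nbhd (cycle_times_path m n)"
  have "Suc j' < n" using j assms(2) by (metis Suc_lessI even_Suc)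
  moreover obtain l where l: "j' = Suc l" using j(3) by (cases j') auto
  moreover have "4 dvd Suc j' \<longleftrightarrow> \<not> 4 dvd l" using j(3) l by presburger
  ultimately have "{2, 3} \<subseteq> ?f ` {(k' mod m, Suc j'), (k' mod m, l)}"
    using j(3) by auto
  also have "\<dots> \<subseteq> ?f ` ?N (Suc k' mod m, j')"
    using \<open>Suc j' < n\<close> l j assms
    by (intro image_mono, subst closed_nbhd_cycle_times_path) auto
  finally have "{2, 3} \<subseteq> ?f ` ?N (Suc k' mod m, j')" .
  moreover have "\<not> {2, 3} \<subseteq> ?f ` ?N (Suc k mod m, j)"
    using j assms by (subst closed_nbhd_cycle_times_path) auto
  ultimately have "?f ` ?N (Suc k mod m, j) \<noteq> ?f ` ?N (Suc k' mod m, j')" by metis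
  then show "?f (Suc k mod m, j) \<noteq> ?f (Suc k' mod m, j') \<and>
      ?f ` ?N (Suc k mod m, j) \<noteq> ?f ` ?N (Suc k' mod m, j')"
    using j by simp
qed auto

section \<open>The pattern coloring\<close>

definition pattern :: "nat \<Rightarrow> nat \<Rightarrow> nat" where
  "pattern m k = (if even (k mod m div 2) then 2 else 3)"

text \<open>\<open>i + m - 1\<close> stands for the cyclic predecessor of \<open>i\<close>, also at
  \<open>i = 0\<close>.\<close>

definition pattern_coloring :: "nat \<Rightarrow> nat \<times> nat \<Rightarrow> nat" where
  "pattern_coloring m = (\<lambda>(i, j). if odd j then pattern m i
     else if pattern m (i + m - 1) = pattern m (Suc i) then 4 else 1)"

lemma pattern_mod [simp]: "pattern m (k mod m) = pattern m k"
  by (simp add: pattern_def)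

lemma pattern_range: "pattern m k = 2 \<or> pattern m k = 3"
  by (simp add: pattern_def)

lemma pattern_add_period: "pattern m (k + m) = pattern m k"
  by (simp add: pattern_def)

lemma pattern_coloring_odd:
  "odd j \<Longrightarrow> pattern_coloring m (k mod m, j) = pattern m k"
  by (simp add: pattern_coloring_def)

lemma pattern_coloring_even:
  assumes "even j" "m > 0"
  shows "pattern_coloring m (Suc k mod m, j) = (if pattern m k = pattern m (k + 2) then 4 else 1)"
proof -
  have "(Suc k mod m + m - 1) mod m = (Suc k mod m + (m - 1)) mod m"
    using assms by simp
  also have "\<dots> = (Suc k + (m - 1)) mod m" by (rule mod_add_left_eq)
  also have "\<dots> = k mod m" using assms by simp
  finally have "pattern m (Suc k mod m + m - 1) = pattern m k"
    by (metis pattern_mod)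
  moreover have "pattern m (Suc (Suc k mod m)) = pattern m (k + 2)"
    by (metis pattern_mod mod_Suc_eq add_2_eq_Suc')
  ultimately show ?thesis using assms by (simp add: pattern_coloring_def)
qed

lemma add_2_mod:
  assumes "m \<ge> (2::nat)"
  shows "(k + 2) mod m = (if k mod m + 2 < m then k mod m + 2 else k mod m + 2 - m)"
proof -
  have "(k + 2) mod m = (k mod m + 2) mod m" by (simp only: mod_add_left_eq)
  moreover have "k mod m < m" using assms by simp
  ultimately show ?thesis using assms
    by (cases "k mod m + 2 < m") (auto simp: le_mod_geq)
qed

text \<open>A step of two changes the parity of the block index \<open>k mod m div 2\<close> unless
  it wraps around, so a repeat needs a wrap. For \<open>m \<ge> 4\<close> the next step of two then
  starts at position \<open>0\<close> or \<open>1\<close> and does not wrap.\<close>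

lemma pattern_no_two_repeats:
  assumes "m \<ge> 3" "pattern m k = pattern m (k + 2)"
  shows "pattern m (k + 2) \<noteq> pattern m (k + 4)"
proof -
  define i where "i = k mod m"
  have i: "i < m" using assms by (simp add: i_def)
  have 1: "(k + 2) mod m = (if i + 2 < m then i + 2 else i + 2 - m)"
    using add_2_mod[of m k] assms by (simp add: i_def)
  have 2: "(k + 4) mod m =
      (if (k + 2) mod m + 2 < m then (k + 2) mod m + 2 else (k + 2) mod m + 2 - m)"
    using add_2_mod[of m "k + 2"] assms(1) by (simp only: add.assoc) simp
  have wrap: "i + 2 \<ge> m"
    using assms(2) 1 by (auto simp: pattern_def i_def[symmetric] split: if_splits)
  show ?thesis
  \<comment> \<open>For \<open>m = 3\<close> both steps wrap when \<open>i = 2\<close>, so this case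
    is computed directly.\<close>
  proof (cases "m = 3")
    case True
    then have "i = 1 \<or> i = 2" using i wrap by auto
    then show ?thesis
      using assms(2) 1 2 True unfolding pattern_def i_def[symmetric] by (elim disjE) simp_all
  next
    case False
    then have "i + 2 - m + 2 < m" using i assms(1) by linarith
    then show ?thesis
      using wrap 1 2 by (auto simp: pattern_def i_def[symmetric])
  qed
qed

text \<open>Wrapping subtracts a multiple of \<open>4\<close>, so a step of two flips the parity of
  the block index even across the wrap.\<close>

lemma pattern_alternates:
  assumes "m \<ge> 3" "4 dvd m"
  shows "pattern m k \<noteq> pattern m (k + 2)"
proof -
  define i where "i = k mod m"
  have "i < m" using assms by (simp add: i_def)
  moreover have "(k + 2) mod m = (if i + 2 < m then i + 2 else i + 2 - m)"
    using add_2_mod[of m k] assms by (simp add: i_def)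
  moreover have "even ((i + 2 - m) div 2) \<longleftrightarrow> odd (i div 2)" if "i + 2 \<ge> m"
    using that assms(2) \<open>i < m\<close> by presburger
  ultimately show ?thesis
    by (auto simp: pattern_def i_def[symmetric])
qed

text \<open>If the cyclic neighbors of the even-layer endpoint of an edge carry different entries,
  it sees both \<open>2\<close> and \<open>3\<close>, of which the odd-layer endpoint sees only its
  own. If they carry the same entry, color \<open>1\<close> separates: it is missing at the
  even-layer endpoint and present at the other. If \<open>4\<close> divides \<open>m\<close>, color
  \<open>4\<close> never occurs.\<close>

lemma lid_coloring_pattern:
  assumes "m \<ge> 3" "c = 4 \<or> 4 dvd m \<and> c = 3"
  shows "lid_coloring (cycle_times_path m n) c (pattern_coloring m)"
    (is "lid_coloring _ _ ?f")
proof (rule lid_coloring_cycle_times_pathI)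
  have "?f (i, j) \<in> {1..c}" if i: "i < m" for i j
  proof -
    obtain k where k: "i = Suc k mod m" using obtain_Suc_mod[OF i] by blast
    show ?thesis
      using assms pattern_alternates[of m k] pattern_range[of m "Suc k"] unfolding k
      by (cases "even j") (auto simp: pattern_coloring_odd pattern_coloring_even)
  qed
  then show "?f ` ({0..<m} \<times> {0..<n}) \<subseteq> {1..c}" by auto
next
  fix k k' j j' :: nat
  assume j: "even j" "j < n" "odd j'" "j' < n" "j' = Suc j \<or> j = Suc j'"
    and k': "Suc k' mod m = k mod m \<or> Suc k' mod m = (k + 2) mod m"
  let ?N = "closed_nbhd (cycle_times_path m n)"
  have m: "m > 0" using assms by simp
  have neq: "?f (Suc k mod m, j) \<noteq> ?f (Suc k' mod m, j')"
    using j m pattern_range[of m "Suc k'"]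
    by (auto simp: pattern_coloring_odd pattern_coloring_even)
  have "?f ` ?N (Suc k mod m, j) \<noteq> ?f ` ?N (Suc k' mod m, j')"
  proof (cases "pattern m k = pattern m (k + 2)")
    case False
    then have "{2, 3} \<subseteq> {pattern m k, pattern m (k + 2)}"
      using pattern_range[of m k] pattern_range[of m "k + 2"] by auto
    also have "\<dots> = ?f ` {(k mod m, j'), ((k + 2) mod m, j')}"
      using j pattern_coloring_odd[of j' m] by simp
    also have "\<dots> \<subseteq> ?f ` ?N (Suc k mod m, j)"
      using j m by (intro image_mono, subst closed_nbhd_cycle_times_path) auto
    finally have "{2, 3} \<subseteq> ?f ` ?N (Suc k mod m, j)" .
    moreover have "?f ` ?N (Suc k' mod m, j') \<subseteq> {1, 4, pattern m (Suc k')}"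
      using j m by (subst closed_nbhd_cycle_times_path) (auto simp: pattern_coloring_def)
    moreover have "\<not> {2, 3} \<subseteq> {1, 4, pattern m (Suc k')}" by auto
    ultimately show ?thesis by (metis order_trans)
  next
    case True
    have "1 \<notin> ?f ` ?N (Suc k mod m, j)"
    proof -
      have "?f ` ?N (Suc k mod m, j) \<subseteq> {4, pattern m k, pattern m (k + 2)}"
        using j m True
        by (subst closed_nbhd_cycle_times_path)
          (auto simp: pattern_coloring_even pattern_coloring_odd)
      moreover have "1 \<notin> {4, pattern m k, pattern m (k + 2)}"
        using pattern_range[of m k] pattern_range[of m "k + 2"] by auto
      ultimately show ?thesis by (metis subsetD)
    qed
    moreover have "1 \<in> ?f ` ?N (Suc k' mod m, j')"
    proof -
      \<comment> \<open>\<open>h\<close> is the cyclic neighbor of \<open>Suc k'\<close> other than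
        \<open>Suc k\<close>. It lies two positions from \<open>Suc k\<close>, whose neighbors
        repeat an entry, so its own neighbors cannot, and it has color \<open>1\<close>.\<close>
      obtain h where h: "h mod m = k' mod m \<or> h mod m = (k' + 2) mod m"
        "?f (h mod m, j) = 1"
      proof (cases "Suc k' mod m = (k + 2) mod m")
        case True
        then have "Suc k' mod m = Suc (Suc k) mod m" by simp
        then have "(k' + 2) mod m = Suc (k + 2) mod m"
          by (metis add_2_eq_Suc' mod_Suc_eq)
        moreover have "?f (Suc (k + 2) mod m, j) = 1"
          using pattern_no_two_repeats[OF assms(1) \<open>pattern m k = _\<close>] j m
            pattern_coloring_even[of j m "k + 2"] by (simp add: numeral_eq_Suc)
        ultimately show ?thesis using that[of "Suc (k + 2)"] by simp
      next
        case False
        then have "k mod m = Suc k' mod m" using k' by simp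
        \<comment> \<open>\<open>g\<close> represents \<open>k - 2\<close> modulo \<open>m\<close>;
          a repeat from \<open>g\<close> to \<open>g + 2\<close> would be followed at once by the
          one from \<open>k\<close> to \<open>k + 2\<close>.\<close>
        define g where "g = k' + m - 1"
        have g: "Suc g = k' + m" using m by (simp add: g_def)
        have "pattern m (g + 2) = pattern m k"
          using g \<open>k mod m = _\<close> pattern_add_period[of m "Suc k'"]
          by (metis add_2_eq_Suc' add_Suc pattern_mod)
        moreover have "pattern m (g + 4) = pattern m (k + 2)"
        proof -
          have "(k + 2) mod m = (Suc k' + 2) mod m"
            using \<open>k mod m = _\<close> by (metis mod_add_left_eq)
          then have "pattern m (k + 2) = pattern m (Suc k' + 2)"
            by (metis pattern_mod)
          also have "\<dots> = pattern m (Suc k' + 2 + m)" by (simp only: pattern_add_period)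
          also have "Suc k' + 2 + m = g + 4" using g by simp
          finally show ?thesis by simp
        qed
        ultimately have "pattern m g \<noteq> pattern m (g + 2)"
          using pattern_no_two_repeats[OF assms(1), of g] True by auto
        then have "?f (Suc g mod m, j) = 1"
          using j m by (simp add: pattern_coloring_even)
        then show ?thesis using that[of "Suc g"] g by simp
      qed
      have "(h mod m, j) \<in> ?N (Suc k' mod m, j')"
        using h(1) j m by (subst closed_nbhd_cycle_times_path) auto
      then show ?thesis using h(2) by (metis imageI)
    qed
    ultimately show ?thesis by metis
  qed
  with neq show "?f (Suc k mod m, j) \<noteq> ?f (Suc k' mod m, j') \<and>
      ?f ` ?N (Suc k mod m, j) \<noteq> ?f ` ?N (Suc k' mod m, j')" ..
qed

section \<open>Color sets of closed neighborhoods under two or three colors\<close>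

lemma lid_coloring_image_closed_nbhd:
  assumes "lid_coloring G c f" "simple_graph G" "{u, v} \<in> edges G"
  shows "{f u, f v} \<subseteq> f ` closed_nbhd G u" "f ` closed_nbhd G u \<subseteq> {1..c}" "f u \<noteq> f v"
proof -
  have uv: "u \<in> verts G" "v \<in> verts G"
    using assms(2,3) by (auto simp: simple_graph_def)
  then have "closed_nbhd G u \<subseteq> verts G" by (auto simp: closed_nbhd_def)
  then show "f ` closed_nbhd G u \<subseteq> {1..c}"
    using assms(1) by (auto simp: lid_coloring_def proper_coloring_def)
  show "{f u, f v} \<subseteq> f ` closed_nbhd G u"
    using uv assms(3) by (auto simp: closed_nbhd_def insert_commute)
  show "f u \<noteq> f v"
    using assms by (auto simp: lid_coloring_def proper_coloring_def)
qed

text \<open>Both endpoints of an edge see both colors, so the lid condition can hold only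
  vacuously.\<close>

lemma lid_coloring_two_colors_closed_nbhd_eq:
  assumes "lid_coloring G 2 f" "simple_graph G" "{u, v} \<in> edges G"
  shows "closed_nbhd G u = closed_nbhd G v"
proof -
  have "f ` closed_nbhd G x = {1..2}" if "{x, y} \<in> edges G" for x y
  proof (rule antisym)
    note * = lid_coloring_image_closed_nbhd[OF assms(1,2) that]
    show "f ` closed_nbhd G x \<subseteq> {1..2}" using *(2) .
    have "{f x, f y} \<subseteq> {1..2}" using *(1,2) by blast
    then have "{1..2} = {f x, f y}" using *(3) by (auto simp: atLeastAtMost_iff)
    then show "{1..2} \<subseteq> f ` closed_nbhd G x" using *(1) by simp
  qed
  then have "f ` closed_nbhd G u = f ` closed_nbhd G v"
    using assms(3) by (metis insert_commute)
  then show ?thesis using assms(1,3) unfolding lid_coloring_def by blast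
qed

text \<open>An edge already shows two of the three colors, so an endpoint that misses a color sees
  exactly these two. If both endpoints missed a color, their color sets would coincide, as they
  would if both saw all three.\<close>

lemma lid_coloring_three_colors_alternate:
  assumes "lid_coloring G 3 f" "simple_graph G" "{u, v} \<in> edges G"
    and "closed_nbhd G u \<noteq> closed_nbhd G v"
  shows "f ` closed_nbhd G u = {1..3} \<longleftrightarrow> f ` closed_nbhd G v \<noteq> {1..3}"
    and "f ` closed_nbhd G u \<noteq> {1..3} \<Longrightarrow> f ` closed_nbhd G u = {f u, f v}"
proof -
  have two: "f ` closed_nbhd G x = {f x, f y}"
    if "{x, y} \<in> edges G" "f ` closed_nbhd G x \<noteq> {1..3}" for x y
  proof (rule antisym)
    note * = lid_coloring_image_closed_nbhd[OF assms(1,2) that(1)]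
    show "{f x, f y} \<subseteq> f ` closed_nbhd G x" using *(1) .
    have "finite (f ` closed_nbhd G x)" using *(2) finite_subset by blast
    have "f ` closed_nbhd G x \<subset> {1..3}" using *(2) that(2) by blast
    then have "card (f ` closed_nbhd G x) < 3"
      using psubset_card_mono[of "{1..3}" "f ` closed_nbhd G x"] by simp
    then have "card (f ` closed_nbhd G x) \<le> card {f x, f y}" using *(3) by simp
    with \<open>finite _\<close> *(1) have "{f x, f y} = f ` closed_nbhd G x" by (rule card_seteq)
    then show "f ` closed_nbhd G x \<subseteq> {f x, f y}" by simp
  qed
  show "f ` closed_nbhd G u \<noteq> {1..3} \<Longrightarrow> f ` closed_nbhd G u = {f u, f v}"
    using two assms(3) by blast
  have "f ` closed_nbhd G u \<noteq> f ` closed_nbhd G v"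
    using assms by (auto simp: lid_coloring_def)
  then show "f ` closed_nbhd G u = {1..3} \<longleftrightarrow> f ` closed_nbhd G v \<noteq> {1..3}"
    using two[of u v] two[of v u] assms(3) by (metis insert_commute)
qed

section \<open>Divisibility of the cycle length by \<open>4\<close>\<close>

lemma four_dvd_if_alternating_periodic:
  fixes b :: "nat \<Rightarrow> nat"
  assumes "\<And>k. b (k + m) = b k"
    and "\<And>t. b (c + 2 * t) \<in> {x, y}" and "\<And>t. b (c + 2 * t) \<noteq> b (c + 2 * Suc t)"
  shows "4 dvd m"
proof -
  have alt: "b (c + 2 * t) = b c \<longleftrightarrow> even t" for t
  proof (induction t)
    case (Suc t)
    then show ?case
      using assms(2)[of 0] assms(2)[of t] assms(2)[of "Suc t"] assms(3)[of t] by auto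
  qed simp
  \<comment> \<open>Taking \<open>t = m\<close> goes around the cycle twice, which works for either
    parity of \<open>m\<close>; once \<open>m\<close> is known to be even, half of it goes around
    once.\<close>
  have "b (c + 2 * m) = b c" using assms(1)[of "c + m"] assms(1)[of c] by (simp add: mult_2 add.assoc)
  then have "even m" using alt by blast
  then obtain t where t: "m = 2 * t" by blast
  then have "even t" using alt[of t] assms(1)[of c] by simp
  then show ?thesis using t by auto
qed

text \<open>The singleton condition makes \<open>j\<close> a boundary layer with \<open>j'\<close>
  next to it, which treats the first and the last layer alike.\<close>

lemma four_dvd_if_boundary_layer_full:
  assumes "m \<ge> 3" "lid_coloring (cycle_times_path m n) 3 f"
    and j: "j < n" "j' < n" "{l. l < n \<and> (l = Suc j \<or> j = Suc l)} = {j'}"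
    and full: "f ` closed_nbhd (cycle_times_path m n) (c mod m, j) = {1..3}"
  shows "4 dvd m"
proof -
  let ?G = "cycle_times_path m n"
  let ?N = "closed_nbhd ?G"
  have m: "m > 0" using assms by simp
  have G: "simple_graph ?G"
    by (intro simple_graph_tensor simple_graph_cycle simple_graph_path assms)
  have j': "j' = Suc j \<or> j = Suc j'" using j by auto
  have edge: "{(k mod m, j), (Suc k mod m, j')} \<in> edges ?G"
    "{(Suc k mod m, j), (k mod m, j')} \<in> edges ?G" for k
    using j j' m by (auto simp: edge_cycle_times_path_iff mod_Suc_eq)
  note alt = lid_coloring_three_colors_alternate[OF assms(2) G _ closed_nbhd_neq[OF assms(1)]]
  \<comment> \<open>The vertex at \<open>Suc k\<close> in layer \<open>j'\<close> sees only two
    colors, its own and a single one shared by its neighbors at \<open>k\<close> and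
    \<open>k + 2\<close> in layer \<open>j\<close>.\<close>
  have step: "f ` ?N (Suc (Suc k) mod m, j) = {1..3} \<and> f (Suc (Suc k) mod m, j) = f (k mod m, j)"
    if "f ` ?N (k mod m, j) = {1..3}" for k
  proof -
    have e: "{(Suc k mod m, j'), (k mod m, j)} \<in> edges ?G"
      "{(Suc k mod m, j'), (Suc (Suc k) mod m, j)} \<in> edges ?G"
      using edge(1)[of k] edge(2)[of "Suc k"] by (simp_all add: insert_commute)
    have n: "f ` ?N (Suc k mod m, j') \<noteq> {1..3}" using alt(1)[OF e(1) e(1)] that by blast
    then have "{f (Suc k mod m, j'), f (k mod m, j)} =
        {f (Suc k mod m, j'), f (Suc (Suc k) mod m, j)}"
      using alt(2)[OF e(1) e(1)] alt(2)[OF e(2) e(2)] by simp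
    then have "f (Suc (Suc k) mod m, j) = f (k mod m, j)"
      by (auto simp: doubleton_eq_iff)
    then show ?thesis using alt(1)[OF e(2) e(2)] n by blast
  qed
  have row: "f ` ?N ((c + 2 * t) mod m, j) = {1..3} \<and> f ((c + 2 * t) mod m, j) = f (c mod m, j)"
    for t
    by (induction t) (use full step in auto)
  define b where "b k = f (k mod m, j')" for k
  \<comment> \<open>The vertex of layer \<open>j\<close> between these two positions is at
    \<open>c + 2 * t + 2\<close>, hence \<open>row\<close> at \<open>Suc t\<close>. It sees all
    three colors and has no other neighbors, so they supply both colors besides its own.\<close>
  have row': "{b (Suc c + 2 * t), b (Suc c + 2 * Suc t)} \<supseteq> {1..3} - {f (c mod m, j)}" for t
  proof -
    let ?k = "c + 2 * t + 1"
    have "{1..3} = f ` ?N (Suc ?k mod m, j)" using row[of "Suc t"] by simp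
    also have "?N (Suc ?k mod m, j) =
        insert (Suc ?k mod m, j) ({?k mod m, (?k + 2) mod m} \<times> {j'})"
      using closed_nbhd_cycle_times_path[OF j(1) m, of ?k] j(3) by simp
    finally have "{1..3} = {f (Suc ?k mod m, j), b ?k, b (?k + 2)}"
      by (simp add: b_def)
    moreover have "f (Suc ?k mod m, j) = f (c mod m, j)" using row[of "Suc t"] by simp
    ultimately show ?thesis by auto
  qed
  have "f (c mod m, j) \<in> {1..3}"
    using full by (auto simp: closed_nbhd_def)
  then obtain x y where xy: "{1..3} - {f (c mod m, j)} = {x, y}" "x \<noteq> y"
  proof -
    have "card ({1..3} - {f (c mod m, j)}) = 2" using \<open>_ \<in> {1..3}\<close> by simp
    then show ?thesis using that by (auto simp: card_2_iff)
  qed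
  have pair: "{x, y} \<subseteq> {b (Suc c + 2 * t), b (Suc c + 2 * Suc t)}" for t
    using row'[of t] unfolding xy(1) .
  show ?thesis
  proof (rule four_dvd_if_alternating_periodic[of b m "Suc c" x y])
    show "b (k + m) = b k" for k by (simp add: b_def)
    show "b (Suc c + 2 * t) \<in> {x, y}" for t
      using pair[of t] xy(2) by blast
    show "b (Suc c + 2 * t) \<noteq> b (Suc c + 2 * Suc t)" for t
      using pair[of t] xy(2) by (metis insert_absorb2 insert_subset singletonD)
  qed
qed

text \<open>For even \<open>n\<close> the zigzag \<open>(0, 0), (1, 1), (0, 2), \<dots>\<close> ends
  at \<open>(1, n - 1)\<close>. Seeing all three colors alternates along it, so one of its two ends
  does, and both lie in boundary layers.\<close>

lemma four_dvd_if_lid_coloring_three_colors: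
  assumes "m \<ge> 3" "n \<ge> 2" "even n" "lid_coloring (cycle_times_path m n) 3 f"
  shows "4 dvd m"
proof -
  let ?G = "cycle_times_path m n"
  let ?full = "\<lambda>k j. f ` closed_nbhd ?G (k mod m, j) = {1..3}"
  have m: "m > 0" using assms by simp
  have G: "simple_graph ?G"
    by (intro simple_graph_tensor simple_graph_cycle simple_graph_path assms)
  note alt = lid_coloring_three_colors_alternate(1)[OF assms(4) G _ closed_nbhd_neq[OF assms(1)]]
  have up: "?full k j \<longleftrightarrow> \<not> ?full (Suc k) (Suc j)" "?full (Suc k) j \<longleftrightarrow> \<not> ?full k (Suc j)"
    if "Suc j < n" for k j
  proof -
    have e: "{(k mod m, j), (Suc k mod m, Suc j)} \<in> edges ?G"
      "{(Suc k mod m, j), (k mod m, Suc j)} \<in> edges ?G"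
      using that m by (auto simp: edge_cycle_times_path_iff mod_Suc_eq)
    show "?full k j \<longleftrightarrow> \<not> ?full (Suc k) (Suc j)" "?full (Suc k) j \<longleftrightarrow> \<not> ?full k (Suc j)"
      using alt[OF e(1) e(1)] alt[OF e(2) e(2)] by blast+
  qed
  have odd_layers: "?full 1 (Suc (2 * t)) \<longleftrightarrow> \<not> ?full 0 0" if "Suc (2 * t) < n" for t
    using that
  proof (induction t)
    case 0
    then show ?case using up(1)[of 0 0] by simp
  next
    case (Suc t)
    then show ?case
      using up(2)[of "Suc (2 * t)" 0] up(1)[of "Suc (Suc (2 * t))" 0] by simp
  qed
  show ?thesis
  proof (cases "?full 0 0")
    case True
    have "{l. l < n \<and> (l = Suc 0 \<or> 0 = Suc l)} = {1}" using assms(2) by auto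
    from four_dvd_if_boundary_layer_full[OF assms(1,4) _ _ this True] assms(2)
    show ?thesis by simp
  next
    case False
    have n: "n - 1 = Suc (2 * ((n - 2) div 2))" using assms(2,3) by presburger
    then have "?full 1 (n - 1)" using odd_layers[of "(n - 2) div 2"] False assms(2) by simp
    moreover have "{l. l < n \<and> (l = Suc (n - 1) \<or> n - 1 = Suc l)} = {n - 2}"
      using assms(2) by auto
    ultimately show ?thesis
      using four_dvd_if_boundary_layer_full[OF assms(1,4), of "n - 1" "n - 2" 1] assms(2) by simp
  qed
qed

section \<open>Exclusion of two colors and the resulting values\<close>

lemma not_lid_coloring_two_colors:
  assumes "m \<ge> 3" "n \<ge> 2"
  shows "\<not> lid_coloring (cycle_times_path m n) 2 f"
proof
  let ?G = "cycle_times_path m n"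
  assume f: "lid_coloring ?G 2 f"
  have G: "simple_graph ?G"
    by (intro simple_graph_tensor simple_graph_cycle simple_graph_path assms)
  have e: "{(0, 0), (1, 1)} \<in> edges ?G"
    using assms by (simp add: edge_cycle_times_path_iff)
  show False
    using lid_coloring_two_colors_closed_nbhd_eq[OF f G e] closed_nbhd_neq[OF assms(1) e] by simp
qed

theorem theorem9:
  fixes m n :: nat
  assumes "m \<ge> 3" and "n \<ge> 2"
  shows "lid_chromatic_number (tensor_product (cycle_graph m) (path_graph n)) =
    (if odd n then 3
     else if 4 dvd m \<and> even n then 3
     else 4)"
proof (cases "odd n \<or> 4 dvd m")
  case True
  \<comment> \<open>An odd \<open>n\<close> is served by the layer coloring, \<open>4 dvd m\<close>
    by the pattern coloring without color \<open>4\<close>.\<close>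
  then obtain f where "lid_coloring (cycle_times_path m n) (Suc 2) f"
    using lid_coloring_odd_path[OF assms(1), of n] lid_coloring_pattern[OF assms(1), of 3 n]
    by auto
  then have "lid_chromatic_number (cycle_times_path m n) = Suc 2"
    using not_lid_coloring_two_colors[OF assms] by (rule lid_chromatic_number_eqI)
  then show ?thesis using True by auto
next
  case False
  then have "\<not> lid_coloring (cycle_times_path m n) 3 g" for g
    using four_dvd_if_lid_coloring_three_colors[OF assms] by auto
  moreover have "lid_coloring (cycle_times_path m n) (Suc 3) (pattern_coloring m)"
    using lid_coloring_pattern assms(1) by simp
  ultimately have "lid_chromatic_number (cycle_times_path m n) = Suc 3"
    by (intro lid_chromatic_number_eqI)
  then show ?thesis using False by simp
qed

end
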